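(* There is an online algorithm that, against any oblivious adversary and for any sequence of vectors $v_1,\ldots,v_T \in \mathbb{R}^n$ with $\|v_i\|_2 \le 1$ arriving one at a time, decides random signs $x_1,\ldots,x_T \in \{-1,1\}$ such that for every $t \in [T]$ the prefix sum $\sum_{i=1}^t x_i v_i$ is $10$-subgaussian.
   Context: Online setting: the vectors $v_1,v_2,\ldots$ are revealed one at a time. After $v_i$ is revealed, the algorithm must irrevocably choose $x_i\in\{-1,1\}$, possibly using randomness, based only on $v_1,\ldots,v_i$ and $x_1,\ldots,x_{i-1}$. An oblivious adversary fixes the whole sequence of vectors in advance, independently of the algorithm's random choices. For a real random variable $X$, the subgaussian norm is $\|X\|_{\psi_2}:=\inf\{t>0:\mathbb{E}[\exp(X^2/t^2)]\le 2\}$. For a random vector $X\in\mathbb{R}^n$, $\|X\|_{\psi_2,\infty}:=\sup_{w\in S^{n-1}}\|\langle X,w\rangle\|_{\psi_2}$, where $S^{n-1}$ is the Euclidean unit sphere. $X$ is called $c$-subgaussian if $\|X\|_{\psi_2,\infty}\le c$, equivalently $\mathbb{E}[\exp(\langle X,w\rangle^2/c^2)]\le 2$ for every $w\in S^{n-1}$. *)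

theory Defs
  imports "HOL-Probability.Probability"
begin

(* The exponential moment is a nonnegative Lebesgue integral, so it is \<infinity> when
   exp (X^2/t^2) is not integrable, and the norm is \<infinity> when no t is admissible. *)
definition psi2_norm :: "'a measure \<Rightarrow> ('a \<Rightarrow> real) \<Rightarrow> ennreal" where
  "psi2_norm M X =
     Inf {ennreal t | t :: real. t > 0 \<and> (\<integral>\<^sup>+\<omega>. ennreal (exp ((X \<omega>)\<^sup>2 / t\<^sup>2)) \<partial>M) \<le> 2}"

definition psi2_inf_norm :: "'a measure \<Rightarrow> ('a \<Rightarrow> 'b::euclidean_space) \<Rightarrow> ennreal" where
  "psi2_inf_norm M X = (SUP w \<in> sphere 0 1. psi2_norm M (\<lambda>\<omega>. X \<omega> \<bullet> w))"

definition subgaussian :: "real \<Rightarrow> 'a measure \<Rightarrow> ('a \<Rightarrow> 'b::euclidean_space) \<Rightarrow> bool" where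
  "subgaussian c M X \<longleftrightarrow> psi2_inf_norm M X \<le> ennreal c"

(* A vs xs is the law of the next sign x_i, given the revealed vectors vs = [v_1,...,v_i]
   and the earlier signs xs = [x_1,...,x_(i-1)]. *)
type_synonym 'v online_algorithm = "'v list \<Rightarrow> real list \<Rightarrow> real pmf"

definition chooses_signs :: "'v online_algorithm \<Rightarrow> bool" where
  "chooses_signs A \<longleftrightarrow> (\<forall>vs xs. set_pmf (A vs xs) \<subseteq> {-1, 1})"

(* The joint law of [x_1,...,x_t]. *)
primrec signs :: "'v online_algorithm \<Rightarrow> 'v list \<Rightarrow> nat \<Rightarrow> real list pmf" where
  "signs A vs 0 = return_pmf []"
| "signs A vs (Suc t) =
     bind_pmf (signs A vs t) (\<lambda>xs. map_pmf (\<lambda>x. xs @ [x]) (A (take (Suc t) vs) xs))"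

end

(* Call the law of a random vector X dominated if E f(X) <= E f(G) for every nonnegative convex f with
   finite Gaussian mean, where G ~ N(0, 25 I).  Dominated laws are closed under one signed step: for
   |v| <= 1 the sign can be chosen, as a random function of X, so that X +- v is again dominated.
   By a minimax argument this reduces to finding, for each f, a convex g with
   min (f (x + v)) (f (x - v)) <= g x and E g(G) <= E f(G).  This g is the functional analogue of
   Banaszczyk's K * u: on each line in direction v, raise f to the level at which its sublevel
   interval is [x0 - v, x0 + v], then let every sublevel interval grow by v at both ends.  What g loses
   against f near x0 it regains, by convexity, at the translates by +-3v and +-5v, whose Gaussian
   weights suffice.  Testing domination with exponentials bounds the moment generating function, and a
   Gaussian average over the exponents bounds E exp(<X,w>^2/100) by sqrt 2. *)
theory Submission
  imports Defs
begin

section \<open>The density of N(0, 25 I) and its translates\<close>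

definition gauss :: "'a::euclidean_space \<Rightarrow> real" where
  "gauss x = (\<Prod>b\<in>Basis. normal_density 0 5 (x \<bullet> b))"

lemma gauss_eq:
  fixes x :: "'a::euclidean_space"
  shows "gauss x = (1 / sqrt (50 * pi)) ^ DIM('a) * exp (- (x \<bullet> x) / 50)"
proof -
  have "x \<bullet> x = (\<Sum>b\<in>Basis. (x \<bullet> b)\<^sup>2)"
    by (simp add: euclidean_inner[of x x] power2_eq_square)
  then have "- (x \<bullet> x) / 50 = (\<Sum>b\<in>Basis. - (x \<bullet> b)\<^sup>2 / 50)"
    by (simp add: sum_negf sum_divide_distrib)
  then have *: "exp (- (x \<bullet> x) / 50) = (\<Prod>b\<in>Basis. exp (- (x \<bullet> b)\<^sup>2 / 50))"
    by (simp only: exp_sum[OF finite_Basis])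
  have "normal_density 0 5 t = 1 / sqrt (50 * pi) * exp (- t\<^sup>2 / 50)" for t
    by (simp add: normal_density_def)
  then show ?thesis
    unfolding gauss_def * by (simp only: prod.distrib prod_constant)
qed

lemma gauss_nonneg [simp]: "0 \<le> gauss x"
  by (simp add: gauss_def prod_nonneg)

lemma gauss_measurable [measurable]: "gauss \<in> borel_measurable borel"
  unfolding gauss_def[abs_def] by measurable

lemma gauss_uminus [simp]: "gauss (- x) = gauss x"
  by (simp add: gauss_eq)

lemma nn_integral_gauss: "(\<integral>\<^sup>+(x::'a::euclidean_space). gauss x \<partial>lborel) = 1"
proof -
  have "(\<integral>\<^sup>+(x::'a). gauss x \<partial>lborel)
      = (\<integral>\<^sup>+(x::'a). (\<Prod>b\<in>Basis. ennreal (normal_density 0 5 (x \<bullet> b))) \<partial>lborel)"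
    by (simp add: gauss_def prod_ennreal)
  also have "\<dots> = 1"
    by (subst nn_integral_lborel_prod) (auto simp: nn_integral_eq_integral)
  finally show ?thesis .
qed

lemma has_bochner_integral_gauss: "has_bochner_integral lborel (gauss :: 'a::euclidean_space \<Rightarrow> real) 1"
  by (rule has_bochner_integral_nn_integral) (auto simp: nn_integral_gauss)

lemma nn_integral_lborel_shift:
  fixes f :: "'a::euclidean_space \<Rightarrow> ennreal"
  assumes [measurable]: "f \<in> borel_measurable borel"
  shows "(\<integral>\<^sup>+x. f (c + x) \<partial>lborel) = (\<integral>\<^sup>+x. f x \<partial>lborel)"
proof -
  have "(\<integral>\<^sup>+x. f x \<partial>lborel) = (\<integral>\<^sup>+x. f x \<partial>distr lborel borel ((+) c))"
    by (simp add: lborel_distr_plus)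
  also have "\<dots> = (\<integral>\<^sup>+x. f (c + x) \<partial>lborel)"
    by (subst nn_integral_distr) auto
  finally show ?thesis ..
qed

text \<open>Completing the square turns the two shifted densities into
  \<open>gauss x * exp (- b)\<close> times \<open>exp (- a)\<close> and \<open>exp a\<close>. Adding
  them removes the tilt a, which is unbounded in x, by exp a + exp (-a) >= 2; the rest is exp (-b)
  >= 1 - b.\<close>

lemma gauss_shifts_ge:
  fixes x v :: "'a::euclidean_space"
  assumes "norm v \<le> 1"
  shows "gauss x * (2 * (1 - j\<^sup>2 / 50)) \<le> gauss (x + j *\<^sub>R v) + gauss (x - j *\<^sub>R v)"
proof -
  define a where "a = j * (x \<bullet> v) / 25"
  define b where "b = j\<^sup>2 * (v \<bullet> v) / 50"
  have "v \<bullet> v \<le> 1"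
    using assms by (simp add: power2_norm_eq_inner[symmetric] power_le_one)
  then have "b \<le> j\<^sup>2 / 50"
    by (simp add: b_def divide_right_mono mult_left_le)
  then have 1: "1 - j\<^sup>2 / 50 \<le> exp (- b)"
    using exp_ge_add_one_self[of "- b"] by linarith
  have "2 \<le> exp a + exp (- a)"
  proof -
    have "0 \<le> (exp (a/2) - exp (- a/2))\<^sup>2" by simp
    then show ?thesis
      by (simp add: power2_diff exp_double[symmetric] exp_add[symmetric] mult.assoc)
  qed
  then have "exp (- b) * 2 \<le> exp (- b) * (exp a + exp (- a))"
    by (rule mult_left_mono) simp
  then have "2 * (1 - j\<^sup>2 / 50) \<le> exp (- b) * (exp a + exp (- a))"
    by (rule order_trans[rotated]) (use 1 in simp)
  then have "gauss x * (2 * (1 - j\<^sup>2 / 50)) \<le> gauss x * (exp (- b) * (exp a + exp (- a)))"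
    by (rule mult_left_mono) simp
  also have "\<dots> = gauss (x + j *\<^sub>R v) + gauss (x - j *\<^sub>R v)"
  proof -
    have p: "- ((x + j *\<^sub>R v) \<bullet> (x + j *\<^sub>R v)) / 50 = - (x \<bullet> x) / 50 + (- b + - a)"
      and m: "- ((x - j *\<^sub>R v) \<bullet> (x - j *\<^sub>R v)) / 50 = - (x \<bullet> x) / 50 + (- b + a)"
      by (simp_all add: a_def b_def inner_commute[of v x] inner_add_left inner_add_right
        inner_diff_left inner_diff_right power2_eq_square)
        (simp_all add: field_simps)
    show ?thesis
      unfolding gauss_eq p m exp_add by (simp add: algebra_simps)
  qed
  finally show ?thesis .
qed

section \<open>Test functions and their Gaussian means\<close>

text \<open>Integrability belongs to the class because a Bochner integral that does not exist is 0,
  and \<open>gauss_mean\<close> would then bound nothing. The class is a convex cone, as the minimax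
  argument requires.\<close>

definition test_fun :: "('a::euclidean_space \<Rightarrow> real) \<Rightarrow> bool" where
  "test_fun f \<longleftrightarrow> convex_on UNIV f \<and> (\<forall>x. 0 \<le> f x) \<and> integrable lborel (\<lambda>x. f x * gauss x)"

definition gauss_mean :: "('a::euclidean_space \<Rightarrow> real) \<Rightarrow> real" where
  "gauss_mean f = (\<integral>x. f x * gauss x \<partial>lborel)"

lemma test_fun_lincomb:
  assumes "test_fun f" "test_fun g" "0 \<le> a" "0 \<le> b"
  shows "test_fun (\<lambda>x. a * f x + b * g x)"
    and "gauss_mean (\<lambda>x. a * f x + b * g x) = a * gauss_mean f + b * gauss_mean g"
  using assms by (auto simp: test_fun_def gauss_mean_def ring_distribs mult.assoc)

lemma convex_on_UNIV_measurable:
  fixes f :: "'a::euclidean_space \<Rightarrow> real"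
  shows "convex_on UNIV f \<Longrightarrow> f \<in> borel_measurable borel"
  by (intro borel_measurable_continuous_onI convex_on_continuous) auto

text \<open>This makes the point mass at 0 dominated, the start of the induction. The Gaussian is
  symmetric, so f x may be averaged with f (-x), and midpoint convexity bounds that average below by
  f 0.\<close>

lemma Jensen_at_0:
  fixes f :: "'a::euclidean_space \<Rightarrow> real"
  assumes "test_fun f"
  shows "f 0 \<le> gauss_mean f"
proof -
  have f: "convex_on UNIV f" "integrable lborel (\<lambda>x. f x * gauss x)"
    using assms by (auto simp: test_fun_def)
  note [measurable] = convex_on_UNIV_measurable[OF f(1)]
  have lb: "lborel = distr lborel borel (\<lambda>x::'a. - x)"
    using lborel_affine[of "-1::real" "0::'a"] by (simp add: density_1)
  have 1: "integrable lborel (\<lambda>x. f (- x) * gauss x)"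
    using f(2) by (subst (asm) lb) (simp add: integrable_distr_eq)
  have 2: "(\<integral>x. f (- x) * gauss x \<partial>lborel) = gauss_mean f"
    unfolding gauss_mean_def by (subst (2) lb) (simp add: integral_distr)
  have "f 0 \<le> (f x + f (- x)) / 2" for x
    using convex_onD[OF f(1), of "1/2" x "- x"] by simp
  then have 3: "f 0 * gauss x \<le> (f x * gauss x + f (- x) * gauss x) / 2" for x
    using mult_right_mono[of "f 0" "(f x + f (- x)) / 2" "gauss x"] by (simp add: ring_distribs)
  have 4: "integrable lborel (\<lambda>x::'a. f 0 * gauss x)"
    using has_bochner_integral_gauss[where 'a='a] by (auto simp: has_bochner_integral_iff)
  have 5: "integrable lborel (\<lambda>x. (f x * gauss x + f (- x) * gauss x) / 2)"
    using f(2) 1 by auto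
  have "(\<integral>(x::'a). f 0 * gauss x \<partial>lborel)
      \<le> (\<integral>x. (f x * gauss x + f (- x) * gauss x) / 2 \<partial>lborel)"
    by (rule integral_mono[OF 4 5]) (rule 3)
  also have "\<dots> = gauss_mean f"
    using f(2) 1 2 by (simp add: gauss_mean_def)
  finally show ?thesis
    using has_bochner_integral_gauss[where 'a='a] by (simp add: has_bochner_integral_iff)
qed

text \<open>Tilting N(0, 25 I) by \<open>exp (x \<bullet> a)\<close> moves its centre to 25 a;
  completing the square leaves the stated constant.\<close>

lemma has_bochner_integral_exp_inner_gauss:
  fixes a :: "'a::euclidean_space"
  shows "has_bochner_integral lborel (\<lambda>x. exp (x \<bullet> a) * gauss x) (exp (25 / 2 * (a \<bullet> a)))"
proof (rule has_bochner_integral_nn_integral)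
  have *: "exp (x \<bullet> a) * gauss x = exp (25 / 2 * (a \<bullet> a)) * gauss (- 25 *\<^sub>R a + x)" for x :: 'a
  proof -
    have "x \<bullet> a + - (x \<bullet> x) / 50
        = 25 / 2 * (a \<bullet> a) + - ((- 25 *\<^sub>R a + x) \<bullet> (- 25 *\<^sub>R a + x)) / 50"
      by (simp add: inner_commute[of a x] inner_diff_left inner_diff_right field_simps)
    then have "exp (x \<bullet> a) * exp (- (x \<bullet> x) / 50) = exp (25 / 2 * (a \<bullet> a)) *
        exp (- ((- 25 *\<^sub>R a + x) \<bullet> (- 25 *\<^sub>R a + x)) / 50)"
      by (simp only: exp_add[symmetric])
    then show ?thesis
      unfolding gauss_eq by (simp only: mult.left_commute[of _ "_ ^ _"])
  qed
  show "(\<integral>\<^sup>+x. exp (x \<bullet> a) * gauss x \<partial>lborel) = exp (25 / 2 * (a \<bullet> a))"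
    unfolding * using nn_integral_lborel_shift[of "\<lambda>x. ennreal (gauss x)" "- 25 *\<^sub>R a"]
    by (simp add: ennreal_mult nn_integral_cmult nn_integral_gauss)
qed auto

lemma convex_on_exp_inner: "convex_on UNIV (\<lambda>x. exp (x \<bullet> a) :: real)"
proof
  fix t :: real and x y assume "0 < t" "t < 1"
  then show "exp (((1 - t) *\<^sub>R x + t *\<^sub>R y) \<bullet> a) \<le> (1 - t) * exp (x \<bullet> a) + t * exp (y \<bullet> a)"
    using convex_onD[OF exp_convex, of t "x \<bullet> a" "y \<bullet> a"] by (simp add: inner_add_left)
qed simp

lemma test_fun_exp_inner: "test_fun (\<lambda>x. exp (x \<bullet> a))"
  and gauss_mean_exp_inner: "gauss_mean (\<lambda>x. exp (x \<bullet> a)) = exp (25 / 2 * (a \<bullet> a))"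
  using has_bochner_integral_exp_inner_gauss[of a]
  by (auto simp: test_fun_def gauss_mean_def convex_on_exp_inner has_bochner_integral_iff)

section \<open>Convexity of partial infima, of maxima and along lines\<close>

text \<open>The infima need not be attained, so parameters that are optimal up to e are combined;
  convexity of S keeps the combination admissible.\<close>

lemma convex_on_INF_joint:
  fixes F :: "'a::real_vector \<Rightarrow> real \<Rightarrow> real"
  assumes S: "convex S" "S \<noteq> {}"
    and nonneg: "\<And>x s. 0 \<le> F x s"
    and joint: "\<And>x y s t u. \<lbrakk>s \<in> S; t \<in> S; 0 < u; u < 1\<rbrakk> \<Longrightarrow>
      F ((1 - u) *\<^sub>R x + u *\<^sub>R y) ((1 - u) * s + u * t) \<le> (1 - u) * F x s + u * F y t"
  shows "convex_on UNIV (\<lambda>x. INF s\<in>S. F x s)"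
proof
  have bdd: "bdd_below (F x ` S)" for x
    using nonneg by (auto intro!: bdd_belowI[of _ 0])
  fix u :: real and x y :: 'a assume u: "0 < u" "u < 1"
  show "(INF s\<in>S. F ((1 - u) *\<^sub>R x + u *\<^sub>R y) s) \<le> (1 - u) * (INF s\<in>S. F x s) + u * (INF s\<in>S. F y s)"
  proof (rule field_le_epsilon)
    fix e :: real assume "0 < e"
    then obtain s t where s: "s \<in> S" "F x s < (INF s\<in>S. F x s) + e"
      and t: "t \<in> S" "F y t < (INF s\<in>S. F y s) + e"
      using S cInf_lessD[of "F x ` S" "(INF s\<in>S. F x s) + e"]
        cInf_lessD[of "F y ` S" "(INF s\<in>S. F y s) + e"] by auto
    have "(1 - u) * s + u * t \<in> S"
      using convexD_alt[OF S(1) s(1) t(1), of u] u by simp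
    then have "(INF s\<in>S. F ((1 - u) *\<^sub>R x + u *\<^sub>R y) s)
        \<le> F ((1 - u) *\<^sub>R x + u *\<^sub>R y) ((1 - u) * s + u * t)"
      by (rule cINF_lower[OF bdd])
    also have "\<dots> \<le> (1 - u) * F x s + u * F y t"
      by (rule joint[OF s(1) t(1) u])
    also have "\<dots> \<le> (1 - u) * ((INF s\<in>S. F x s) + e) + u * ((INF s\<in>S. F y s) + e)"
      using s t u by (intro add_mono mult_left_mono) auto
    finally show "(INF s\<in>S. F ((1 - u) *\<^sub>R x + u *\<^sub>R y) s)
        \<le> (1 - u) * (INF s\<in>S. F x s) + u * (INF s\<in>S. F y s) + e"
      by (simp add: algebra_simps)
  qed
qed simp

lemma convex_on_max:
  assumes "convex_on A f" "convex_on A g"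
  shows "convex_on A (\<lambda>x. max (f x) (g x))"
proof
  fix t :: real and x y assume t: "0 < t" "t < 1" and xy: "x \<in> A" "y \<in> A"
  have "f ((1 - t) *\<^sub>R x + t *\<^sub>R y) \<le> (1 - t) * f x + t * f y"
    "g ((1 - t) *\<^sub>R x + t *\<^sub>R y) \<le> (1 - t) * g x + t * g y"
    using t xy assms by (auto intro: convex_onD)
  moreover have "(1 - t) * f x + t * f y \<le> (1 - t) * max (f x) (g x) + t * max (f y) (g y)"
    "(1 - t) * g x + t * g y \<le> (1 - t) * max (f x) (g x) + t * max (f y) (g y)"
    using t by (intro add_mono mult_left_mono; simp)+
  ultimately show "max (f ((1 - t) *\<^sub>R x + t *\<^sub>R y)) (g ((1 - t) *\<^sub>R x + t *\<^sub>R y))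
      \<le> (1 - t) * max (f x) (g x) + t * max (f y) (g y)"
    by linarith
qed (rule convex_on_imp_convex[OF assms(1)])

lemma convex_on_line:
  assumes "convex_on UNIV f"
  shows "convex_on UNIV (\<lambda>r::real. f (x + r *\<^sub>R v))"
proof
  fix t r s :: real assume t: "0 < t" "t < 1"
  have "x + ((1 - t) *\<^sub>R r + t *\<^sub>R s) *\<^sub>R v = (1 - t) *\<^sub>R (x + r *\<^sub>R v) + t *\<^sub>R (x + s *\<^sub>R v)"
    by (simp add: algebra_simps)
  then show "f (x + ((1 - t) *\<^sub>R r + t *\<^sub>R s) *\<^sub>R v) \<le> (1 - t) * f (x + r *\<^sub>R v) + t * f (x + s *\<^sub>R v)"
    using t convex_onD[OF assms, of t "x + r *\<^sub>R v" "x + s *\<^sub>R v"] by simp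
qed simp

(* The height at which f restricted to the line x + r v has a horizontal chord of length 2 in r, or
   its infimum on the line if there is no such chord. *)
definition chord_level :: "('a::real_vector \<Rightarrow> real) \<Rightarrow> 'a \<Rightarrow> 'a \<Rightarrow> real" where
  "chord_level f v x = (INF s. max (f (x + (s + 1) *\<^sub>R v)) (f (x + (s - 1) *\<^sub>R v)))"

text \<open>For nonnegative f its strict sublevel sets are those of f plus the segment [-v, v]: each
  chord in direction v grows by v at both ends.\<close>

definition segment_inf :: "('a::real_vector \<Rightarrow> real) \<Rightarrow> 'a \<Rightarrow> 'a \<Rightarrow> real" where
  "segment_inf f v x = (INF s\<in>{-1..1}. f (x + s *\<^sub>R v))"

text \<open>The chord level is constant on lines in direction v. Taking the maximum removes from the
  sublevel set at height h every line on which {f < h} has no two points 2 v apart, as in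
  Banaszczyk's operation.\<close>

definition envelope :: "('a::real_vector \<Rightarrow> real) \<Rightarrow> 'a \<Rightarrow> 'a \<Rightarrow> real" where
  "envelope f v x = max (chord_level f v x) (segment_inf f v x)"

section \<open>The envelope along a line in direction v\<close>

context
  fixes f :: "'a::real_vector \<Rightarrow> real"
  assumes conv: "convex_on UNIV f" and nonneg: "\<And>x. 0 \<le> f x"
begin

lemma bdd_below_nonneg: "bdd_below ((\<lambda>s. f (g s)) ` S)" "bdd_below ((\<lambda>s. max (f (g s)) (f (h s))) ` S)"
  using nonneg by (auto intro!: bdd_belowI[of _ 0] simp: le_max_iff_disj)

lemma chord_level_le: "chord_level f v x \<le> max (f (x + (s + 1) *\<^sub>R v)) (f (x + (s - 1) *\<^sub>R v))"
  unfolding chord_level_def by (rule cINF_lower[OF bdd_below_nonneg(2)]) simp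

lemma segment_inf_le: "\<bar>s\<bar> \<le> 1 \<Longrightarrow> segment_inf f v x \<le> f (x + s *\<^sub>R v)"
  unfolding segment_inf_def by (rule cINF_lower[OF bdd_below_nonneg(1)]) auto

lemma envelope_nonneg: "0 \<le> envelope f v x"
  unfolding envelope_def segment_inf_def
  by (rule order_trans[OF _ max.cobounded2]) (auto intro!: cINF_greatest nonneg)

text \<open>A partial infimum over s of a jointly convex function: f is evaluated at two points that
  are affine in (x, s).\<close>

lemma convex_on_chord_level: "convex_on UNIV (chord_level f v)"
  unfolding chord_level_def
proof (rule convex_on_INF_joint)
  fix x y :: 'a and s t u :: real assume u: "0 < u" "u < 1"
  have *: "f ((1 - u) *\<^sub>R x + u *\<^sub>R y + ((1 - u) * s + u * t + c) *\<^sub>R v)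
      \<le> (1 - u) * f (x + (s + c) *\<^sub>R v) + u * f (y + (t + c) *\<^sub>R v)" for c
  proof -
    have "(1 - u) *\<^sub>R x + u *\<^sub>R y + ((1 - u) * s + u * t + c) *\<^sub>R v
        = (1 - u) *\<^sub>R (x + (s + c) *\<^sub>R v) + u *\<^sub>R (y + (t + c) *\<^sub>R v)"
      by (simp add: algebra_simps)
    then show ?thesis
      using u convex_onD[OF conv, of u "x + (s + c) *\<^sub>R v" "y + (t + c) *\<^sub>R v"] by simp
  qed
  have "(1 - u) * f (x + (s + c) *\<^sub>R v) + u * f (y + (t + c) *\<^sub>R v)
      \<le> (1 - u) * max (f (x + (s + 1) *\<^sub>R v)) (f (x + (s - 1) *\<^sub>R v)) +
        u * max (f (y + (t + 1) *\<^sub>R v)) (f (y + (t - 1) *\<^sub>R v))" if "c = 1 \<or> c = -1" for c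
    using u that by (intro add_mono mult_left_mono) auto
  from order_trans[OF * this, of 1] order_trans[OF * this, of "-1"]
  show "max (f ((1 - u) *\<^sub>R x + u *\<^sub>R y + ((1 - u) * s + u * t + 1) *\<^sub>R v))
         (f ((1 - u) *\<^sub>R x + u *\<^sub>R y + ((1 - u) * s + u * t - 1) *\<^sub>R v))
      \<le> (1 - u) * max (f (x + (s + 1) *\<^sub>R v)) (f (x + (s - 1) *\<^sub>R v)) +
        u * max (f (y + (t + 1) *\<^sub>R v)) (f (y + (t - 1) *\<^sub>R v))"
    by simp
qed (auto simp: le_max_iff_disj nonneg)

lemma convex_on_segment_inf: "convex_on UNIV (segment_inf f v)"
  unfolding segment_inf_def
proof (rule convex_on_INF_joint)
  fix x y :: 'a and s t u :: real assume u: "0 < u" "u < 1"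
  have "(1 - u) *\<^sub>R x + u *\<^sub>R y + ((1 - u) * s + u * t) *\<^sub>R v
      = (1 - u) *\<^sub>R (x + s *\<^sub>R v) + u *\<^sub>R (y + t *\<^sub>R v)"
    by (simp add: algebra_simps)
  then show "f ((1 - u) *\<^sub>R x + u *\<^sub>R y + ((1 - u) * s + u * t) *\<^sub>R v)
      \<le> (1 - u) * f (x + s *\<^sub>R v) + u * f (y + t *\<^sub>R v)"
    using u convex_onD[OF conv, of u "x + s *\<^sub>R v" "y + t *\<^sub>R v"] by simp
qed (auto simp: nonneg)

lemma convex_on_envelope: "convex_on UNIV (envelope f v)"
  unfolding envelope_def by (intro convex_on_max convex_on_chord_level convex_on_segment_inf)

lemma line_between:
  assumes "a \<le> b" "b \<le> c"
  shows "f (x + b *\<^sub>R v) \<le> max (f (x + a *\<^sub>R v)) (f (x + c *\<^sub>R v))"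
proof (cases "a = c")
  case True
  with assms show ?thesis by simp
next
  case False
  define t where "t = (b - a) / (c - a)"
  have t: "0 \<le> t" "t \<le> 1" using False assms by (auto simp: t_def)
  have "t * (c - a) = b - a" using False by (simp add: t_def)
  then have "(1 - t) * a + t * c = b" by (simp add: algebra_simps)
  then have "f (x + b *\<^sub>R v) \<le> (1 - t) * f (x + a *\<^sub>R v) + t * f (x + c *\<^sub>R v)"
    using convex_onD[OF convex_on_line[OF conv], of t a c x v] t by simp
  also have "\<dots> \<le> (1 - t) * max (f (x + a *\<^sub>R v)) (f (x + c *\<^sub>R v)) + t * max (f (x + a *\<^sub>R v)) (f (x + c *\<^sub>R v))"
    using t by (intro add_mono mult_left_mono) auto
  finally show ?thesis by (simp add: algebra_simps)
qed

lemma line_chord: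
  assumes "0 \<le> b" "b \<le> c"
  shows "c * f (x + b *\<^sub>R v) \<le> (c - b) * f x + b * f (x + c *\<^sub>R v)"
proof (cases "c = 0")
  case True
  with assms show ?thesis by simp
next
  case False
  with assms have c: "c > 0" by simp
  then have eq: "c * (1 - b / c) = c - b" "c * (b / c) = b" by (auto simp: field_simps)
  have "f (x + ((1 - b / c) *\<^sub>R 0 + (b / c) *\<^sub>R c) *\<^sub>R v)
      \<le> (1 - b / c) * f (x + 0 *\<^sub>R v) + b / c * f (x + c *\<^sub>R v)"
    using assms c by (intro convex_onD[OF convex_on_line[OF conv]]) auto
  then have "f (x + b *\<^sub>R v) \<le> (1 - b / c) * f x + b / c * f (x + c *\<^sub>R v)"
    using c by simp
  then have "c * f (x + b *\<^sub>R v) \<le> c * ((1 - b / c) * f x + b / c * f (x + c *\<^sub>R v))"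
    using c by (intro mult_left_mono) auto
  then show ?thesis by (simp only: distrib_left mult.assoc[symmetric] eq)
qed

text \<open>Otherwise f is below m at some r in [-1, 1] and at both ends s - 1, s + 1 of a chord of
  length 2. Then 1 lies between r and s + 1, or -1 between s - 1 and r, and f would be below m there
  by \<open>line_between\<close>.\<close>

lemma min_le_envelope: "min (f (x + v)) (f (x - v)) \<le> envelope f v x"
proof (rule ccontr)
  define m where "m = min (f (x + v)) (f (x - v))"
  have m: "m \<le> f (x + 1 *\<^sub>R v)" "m \<le> f (x + (-1) *\<^sub>R v)" by (auto simp: m_def)
  assume "\<not> m \<le> envelope f v x"
  then have "chord_level f v x < m" "segment_inf f v x < m"
    by (auto simp: envelope_def)
  then obtain s r where s: "f (x + (s + 1) *\<^sub>R v) < m" "f (x + (s - 1) *\<^sub>R v) < m"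
    and r: "f (x + r *\<^sub>R v) < m" "-1 \<le> r" "r \<le> 1"
    unfolding chord_level_def segment_inf_def
    by (auto dest!: cInf_lessD[rotated])
  show False
  proof (cases "s \<ge> 0")
    case True
    then show False
      using line_between[of r 1 "s + 1" x v] r s m by auto
  next
    case False
    then show False
      using line_between[of "s - 1" "-1" r x v] r s m by auto
  qed
qed

lemma chord_level_shift: "chord_level f v (x + r *\<^sub>R v) = chord_level f v x"
proof -
  let ?F = "\<lambda>s. max (f (x + (s + 1) *\<^sub>R v)) (f (x + (s - 1) *\<^sub>R v))"
  have "(\<lambda>s. max (f (x + r *\<^sub>R v + (s + 1) *\<^sub>R v)) (f (x + r *\<^sub>R v + (s - 1) *\<^sub>R v))) = ?F \<circ> (+) r"
    by (auto simp: fun_eq_iff algebra_simps)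
  then have "range (\<lambda>s. max (f (x + r *\<^sub>R v + (s + 1) *\<^sub>R v)) (f (x + r *\<^sub>R v + (s - 1) *\<^sub>R v))) = range ?F"
    by (simp only: image_comp[symmetric] surj_plus)
  then show ?thesis by (simp add: chord_level_def)
qed

lemma envelope_uminus: "chord_level f (- v) x = chord_level f v x" "envelope f (- v) x = envelope f v x"
proof -
  let ?F = "\<lambda>s. max (f (x + (s + 1) *\<^sub>R v)) (f (x + (s - 1) *\<^sub>R v))"
  have "(\<lambda>s. max (f (x + (s + 1) *\<^sub>R (- v))) (f (x + (s - 1) *\<^sub>R (- v)))) = ?F \<circ> uminus"
    by (auto simp: fun_eq_iff algebra_simps max.commute)
  then have "range (\<lambda>s. max (f (x + (s + 1) *\<^sub>R (- v))) (f (x + (s - 1) *\<^sub>R (- v)))) = range ?F"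
    by (simp only: image_comp[symmetric] surj_uminus)
  then show 1: "chord_level f (- v) x = chord_level f v x" by (simp add: chord_level_def)
  have "(\<lambda>s. f (x + s *\<^sub>R (- v))) = (\<lambda>s. f (x + s *\<^sub>R v)) \<circ> uminus"
    by (auto simp: fun_eq_iff)
  then have "(\<lambda>s. f (x + s *\<^sub>R (- v))) ` {-1..1} = (\<lambda>s. f (x + s *\<^sub>R v)) ` {-1..1}"
    by (simp only: image_comp[symmetric] image_uminus_atLeastAtMost) simp
  with 1 show "envelope f (- v) x = envelope f v x"
    by (simp add: envelope_def segment_inf_def)
qed

text \<open>The chord from x to x + 2 v has its lower end at x, so its far end must reach the chord
  level; beyond it f cannot drop again.\<close>

lemma chord_level_le_far:
  assumes "f x < chord_level f v x" "2 \<le> r"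
  shows "chord_level f v x \<le> f (x + r *\<^sub>R v)"
proof -
  have "chord_level f v x \<le> max (f (x + 2 *\<^sub>R v)) (f x)"
    using chord_level_le[of v x 1] by simp
  then show ?thesis
    using line_between[of 0 2 r x v] assms by auto
qed

text \<open>As r - 1 >= 2, both parts of the envelope at x + r v are at most f (x + (r - 1) v). By
  convexity the slope of f over [r - 1, r] is at least that over [0, r - 1], hence at least that
  over [0, 2], where f climbs from f x to at least the chord level.\<close>

lemma envelope_gain_right:
  assumes "f x < chord_level f v x" "3 \<le> r"
  shows "envelope f v (x + r *\<^sub>R v) + (chord_level f v x - f x) / 2 \<le> f (x + r *\<^sub>R v)"
proof -
  let ?\<phi> = "\<lambda>r. f (x + r *\<^sub>R v)"
  have far: "chord_level f v x \<le> ?\<phi> 2" "chord_level f v x \<le> ?\<phi> (r - 1)"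
    using assms by (auto intro: chord_level_le_far)
  have "segment_inf f v (x + r *\<^sub>R v) \<le> ?\<phi> (r - 1)"
    using segment_inf_le[of "-1" v "x + r *\<^sub>R v"] by (simp add: algebra_simps)
  with far have env: "envelope f v (x + r *\<^sub>R v) \<le> ?\<phi> (r - 1)"
    by (simp add: envelope_def chord_level_shift)
  have "r * ?\<phi> (r - 1) \<le> f x + (r - 1) * ?\<phi> r"
    using line_chord[of "r - 1" r x v] assms by simp
  moreover have "(r - 1) * ?\<phi> 2 \<le> (r - 3) * f x + 2 * ?\<phi> (r - 1)"
    using line_chord[of 2 "r - 1" x v] assms by simp
  ultimately have "(r - 1) * (?\<phi> 2 - f x) \<le> (r - 1) * (2 * (?\<phi> r - ?\<phi> (r - 1)))"
    by (simp add: algebra_simps)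
  then have "?\<phi> 2 - f x \<le> 2 * (?\<phi> r - ?\<phi> (r - 1))"
    using assms by simp
  moreover have "a + (h - y) / 2 \<le> d" if "z - y \<le> 2 * (d - b)" "a \<le> b" "h \<le> z" for a b d h y z :: real
    using that by argo
  ultimately show ?thesis using env far(1) by blast
qed

lemma envelope_gain:
  assumes "f x < chord_level f v x" "3 \<le> \<bar>r\<bar>"
  shows "envelope f v (x + r *\<^sub>R v) + (chord_level f v x - f x) / 2 \<le> f (x + r *\<^sub>R v)"
proof (cases "r \<ge> 0")
  case True
  then show ?thesis using envelope_gain_right[of x v r] assms by simp
next
  case False
  then show ?thesis using envelope_gain_right[of x "- v" "- r"] assms by (simp add: envelope_uminus)
qed

text \<open>The segment infimum never exceeds f x, as s = 0 is admissible; only the chord level can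
  raise f.\<close>

lemma envelope_loss:
  assumes "f x < envelope f v x"
  shows "envelope f v x = chord_level f v x" "f x < chord_level f v x"
  using assms segment_inf_le[of 0 v x] by (auto simp: envelope_def max_def split: if_splits)

text \<open>Points of one line strictly below its chord level are less than 2 v apart. This will
  make translates of the loss region disjoint.\<close>

lemma sublevel_shift_disjoint:
  assumes "i + 2 \<le> j" "f (x - i *\<^sub>R v) < chord_level f v x"
  shows "chord_level f v x \<le> f (x - j *\<^sub>R v)"
  using chord_level_le_far[of "x - i *\<^sub>R v" "- v" "j - i"] assms
    chord_level_shift[of v x "- i"]
  by (simp add: envelope_uminus algebra_simps)

end

section \<open>The envelope does not increase the Gaussian mean\<close>

text \<open>A transport argument: the loss at x is charged to the gains at the points x + j v, and
  no point is charged twice. Nonnegative integrals are used because integrability of the envelope is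
  only deduced from this bound.\<close>

lemma nn_integral_envelope_le:
  fixes f :: "'a::euclidean_space \<Rightarrow> real"
  assumes conv: "convex_on UNIV f" and nonneg: "\<And>x. 0 \<le> f x" and v: "norm v \<le> 1"
  shows "(\<integral>\<^sup>+x. max 0 (envelope f v x - f x) * gauss x \<partial>lborel)
    \<le> (\<integral>\<^sup>+x. max 0 (f x - envelope f v x) * gauss x \<partial>lborel)"
proof -
  \<comment> \<open>\<open>envelope_gain\<close> asks for |j| >= 3 and disjointness for gaps of at
    least 2. Each gain is only half the loss, so the weights must add up to 2
    \<open>gauss x\<close>; they reach 2 (1 - 9/50) + 2 (1 - 25/50) = 66/25 times
    \<open>gauss x\<close>.\<close>
  let ?J = "{-5, -3, 3, 5::real}"
  define A where "A = {x. f x < chord_level f v x}"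
  define gain where "gain = (\<lambda>x. max 0 (f x - envelope f v x) * gauss x)"
  note [measurable] = convex_on_UNIV_measurable[OF conv]
    convex_on_UNIV_measurable[OF convex_on_chord_level[OF conv nonneg]]
    convex_on_UNIV_measurable[OF convex_on_envelope[OF conv nonneg]]
  have A [measurable]: "A \<in> sets borel" unfolding A_def by measurable
  have gain [measurable]: "gain \<in> borel_measurable borel" unfolding gain_def by measurable
  have gain_nonneg: "0 \<le> gain x" for x by (simp add: gain_def)
  have loss: "max 0 (envelope f v x - f x) * gauss x \<le> (\<Sum>j\<in>?J. indicator A x * gain (x + j *\<^sub>R v))" for x
  proof (cases "f x < envelope f v x")
    case False
    then show ?thesis by (auto intro!: sum_nonneg gain_nonneg simp del: sum.insert)
  next
    case True
    define l where "l = envelope f v x - f x"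
    note E = envelope_loss[OF conv nonneg True]
    have "0 \<le> l" using True by (simp add: l_def)
    have "l / 2 * gauss (x + j *\<^sub>R v) \<le> gain (x + j *\<^sub>R v)" if "j \<in> ?J" for j
    proof -
      have "envelope f v (x + j *\<^sub>R v) + l / 2 \<le> f (x + j *\<^sub>R v)"
        using envelope_gain[OF conv nonneg E(2), of j] that by (auto simp: E(1) l_def)
      then have "l / 2 \<le> max 0 (f (x + j *\<^sub>R v) - envelope f v (x + j *\<^sub>R v))"
        by (simp add: le_max_iff_disj le_diff_eq add.commute)
      then show ?thesis unfolding gain_def by (rule mult_right_mono) simp
    qed
    then have "(\<Sum>j\<in>?J. l / 2 * gauss (x + j *\<^sub>R v)) \<le> (\<Sum>j\<in>?J. gain (x + j *\<^sub>R v))"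
      by (rule sum_mono)
    moreover have "l * gauss x \<le> (\<Sum>j\<in>?J. l / 2 * gauss (x + j *\<^sub>R v))"
    proof -
      have "gauss x * 41 \<le> (gauss (x + 3 *\<^sub>R v) + gauss (x - 3 *\<^sub>R v)) * 25"
        "gauss x \<le> gauss (x + 5 *\<^sub>R v) + gauss (x - 5 *\<^sub>R v)"
        using gauss_shifts_ge[OF v, of x 3] gauss_shifts_ge[OF v, of x 5] by simp_all
      then have "2 * gauss x \<le> gauss (x - 5 *\<^sub>R v) + (gauss (x - 3 *\<^sub>R v) +
          (gauss (x + 3 *\<^sub>R v) + gauss (x + 5 *\<^sub>R v)))"
        using gauss_nonneg[of x] by argo
      then have "2 * gauss x \<le> (\<Sum>j\<in>?J. gauss (x + j *\<^sub>R v))"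
        by simp
      then have "l / 2 * (2 * gauss x) \<le> l / 2 * (\<Sum>j\<in>?J. gauss (x + j *\<^sub>R v))"
        using \<open>0 \<le> l\<close> by (intro mult_left_mono) auto
      then show ?thesis unfolding sum_distrib_left by (simp del: sum.insert)
    qed
    ultimately show ?thesis
      using E(2) True by (simp add: A_def l_def)
  qed
  \<comment> \<open>The point x is charged through j only if x - j v is in A. Distinct shifts differ
    by at least 2, so this happens for at most one j.\<close>
  have disj: "(\<Sum>j\<in>?J. indicator A (x - j *\<^sub>R v) :: real) \<le> 1" for x
  proof -
    have *: "x - j *\<^sub>R v \<notin> A" if "x - i *\<^sub>R v \<in> A" "i + 2 \<le> j" for i j
      using sublevel_shift_disjoint[OF conv nonneg that(2), of x v] that(1)
        chord_level_shift[OF conv nonneg, of v x "- j"] chord_level_shift[OF conv nonneg, of v x "- i"]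
      by (simp add: A_def)
    have "(\<Sum>j\<in>?J. indicator A (x - j *\<^sub>R v) :: real) = indicator A (x - (-5) *\<^sub>R v) +
        (indicator A (x - (-3) *\<^sub>R v) + (indicator A (x - 3 *\<^sub>R v) + indicator A (x - 5 *\<^sub>R v)))"
      by simp
    then show ?thesis
      using *[of "-5" "-3"] *[of "-5" 3] *[of "-5" 5] *[of "-3" 3] *[of "-3" 5] *[of 3 5]
      by (simp del: sum.insert split: split_indicator)
  qed
  have "(\<integral>\<^sup>+x. max 0 (envelope f v x - f x) * gauss x \<partial>lborel)
      \<le> (\<integral>\<^sup>+x. (\<Sum>j\<in>?J. ennreal (indicator A x * gain (x + j *\<^sub>R v))) \<partial>lborel)"
    using loss gain_nonneg
    by (intro nn_integral_mono) (simp add: sum_ennreal ennreal_leI del: sum.insert)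
  also have "\<dots> = (\<Sum>j\<in>?J. \<integral>\<^sup>+x. ennreal (indicator A x * gain (x + j *\<^sub>R v)) \<partial>lborel)"
    by (rule nn_integral_sum) measurable
  \<comment> \<open>Translation invariance of Lebesgue measure books each charge at the point that
    pays it; the density is part of \<open>gain\<close> and moves along.\<close>
  also have "\<dots> = (\<Sum>j\<in>?J. \<integral>\<^sup>+x. ennreal (indicator A (x - j *\<^sub>R v) * gain x) \<partial>lborel)"
  proof (rule sum.cong)
    fix j
    show "(\<integral>\<^sup>+x. ennreal (indicator A x * gain (x + j *\<^sub>R v)) \<partial>lborel)
        = (\<integral>\<^sup>+x. ennreal (indicator A (x - j *\<^sub>R v) * gain x) \<partial>lborel)"
      using nn_integral_lborel_shift[of "\<lambda>x. ennreal (indicator A (x - j *\<^sub>R v) * gain x)" "j *\<^sub>R v"]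
      by (simp add: add.commute)
  qed simp
  also have "\<dots> = (\<integral>\<^sup>+x. (\<Sum>j\<in>?J. ennreal (indicator A (x - j *\<^sub>R v) * gain x)) \<partial>lborel)"
    by (rule nn_integral_sum[symmetric]) measurable
  also have "\<dots> \<le> (\<integral>\<^sup>+x. gain x \<partial>lborel)"
  proof (intro nn_integral_mono)
    fix x
    have "(\<Sum>j\<in>?J. indicator A (x - j *\<^sub>R v) * gain x) \<le> gain x"
      using mult_right_mono[OF disj gain_nonneg, of x x] by (simp only: sum_distrib_right)
    then show "(\<Sum>j\<in>?J. ennreal (indicator A (x - j *\<^sub>R v) * gain x)) \<le> ennreal (gain x)"
      using gain_nonneg by (subst sum_ennreal) (auto intro: ennreal_leI simp del: sum.insert)
  qed
  finally show ?thesis by (simp add: gain_def)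
qed

text \<open>The envelope is f plus loss minus gain. It is nonnegative, so the gain is dominated by f
  and integrable; the loss has no larger integral, so it is integrable too.\<close>

lemma test_fun_envelope:
  assumes f: "test_fun f" and v: "norm v \<le> 1"
  shows "test_fun (envelope f v)" and "gauss_mean (envelope f v) \<le> gauss_mean f"
proof -
  have conv: "convex_on UNIV f" and nonneg: "\<And>x. 0 \<le> f x"
    and int: "integrable lborel (\<lambda>x. f x * gauss x)"
    using f by (auto simp: test_fun_def)
  define g where "g = envelope f v"
  have g: "convex_on UNIV g" "\<And>x. 0 \<le> g x"
    unfolding g_def using convex_on_envelope[OF conv nonneg] envelope_nonneg[OF conv nonneg] by auto
  note [measurable] = convex_on_UNIV_measurable[OF conv] convex_on_UNIV_measurable[OF g(1)]
  let ?gain = "\<lambda>x. max 0 (f x - g x) * gauss x" and ?loss = "\<lambda>x. max 0 (g x - f x) * gauss x"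
  have gain: "integrable lborel ?gain"
  proof (rule Bochner_Integration.integrable_bound[OF int])
    show "AE x in lborel. norm (?gain x) \<le> norm (f x * gauss x)"
      using g(2) nonneg by (auto simp: abs_mult intro!: AE_I2 mult_right_mono)
  qed measurable
  have le: "(\<integral>\<^sup>+x. ?loss x \<partial>lborel) \<le> (\<integral>\<^sup>+x. ?gain x \<partial>lborel)"
    unfolding g_def by (rule nn_integral_envelope_le[OF conv nonneg v])
  also have "\<dots> = ennreal (\<integral>x. ?gain x \<partial>lborel)"
    by (rule nn_integral_eq_integral[OF gain]) simp
  finally have le: "(\<integral>\<^sup>+x. ?loss x \<partial>lborel) \<le> ennreal (\<integral>x. ?gain x \<partial>lborel)" .
  then have loss: "integrable lborel ?loss"
    by (intro integrableI_nonneg) (auto intro: le_less_trans)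
  have "ennreal (\<integral>x. ?loss x \<partial>lborel) \<le> ennreal (\<integral>x. ?gain x \<partial>lborel)"
    using le by (subst (asm) nn_integral_eq_integral[OF loss]) auto
  then have le: "(\<integral>x. ?loss x \<partial>lborel) \<le> (\<integral>x. ?gain x \<partial>lborel)"
    by (simp add: ennreal_le_iff integral_nonneg_AE)
  have eq: "g x * gauss x = f x * gauss x + ?loss x - ?gain x" for x
    by (simp add: max_def algebra_simps)
  show "test_fun (envelope f v)"
    using g int loss gain unfolding test_fun_def g_def[symmetric] eq by auto
  show "gauss_mean (envelope f v) \<le> gauss_mean f"
    using int loss gain le unfolding gauss_mean_def g_def[symmetric] eq by simp
qed

section \<open>A minimax argument on a convex cone of functions\<close>

text \<open>Functions with u f < w f bound p from below, those with u f > w f from above. Two such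
  bounds cannot conflict: a conic combination of the two functions equalizes u and w, and there the
  hypothesis on the minimum decides. R is superlinear because \<open>choose_weights\<close> puts a
  sum of minima into it.\<close>

lemma choose_weight:
  fixes C :: "('a \<Rightarrow> real) set" and R u w :: "('a \<Rightarrow> real) \<Rightarrow> real"
  assumes closed: "\<And>f g a b. \<lbrakk>f \<in> C; g \<in> C; 0 \<le> a; 0 \<le> b\<rbrakk> \<Longrightarrow> (\<lambda>x. a * f x + b * g x) \<in> C"
    and super: "\<And>f g a b. \<lbrakk>f \<in> C; g \<in> C; 0 \<le> a; 0 \<le> b\<rbrakk> \<Longrightarrow> a * R f + b * R g \<le> R (\<lambda>x. a * f x + b * g x)"
    and u: "\<And>f g a b. u (\<lambda>x. a * f x + b * g x) = a * u f + b * u g"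
    and w: "\<And>f g a b. w (\<lambda>x. a * f x + b * g x) = a * w f + b * w g"
    and min: "\<And>f. f \<in> C \<Longrightarrow> R f + min (u f) (w f) \<le> 0"
  shows "\<exists>p. 0 \<le> p \<and> p \<le> 1 \<and> (\<forall>f\<in>C. R f + (p * u f + (1 - p) * w f) \<le> 0)"
proof -
  define \<alpha> where "\<alpha> = (\<lambda>f. R f + w f)"
  define \<delta> where "\<delta> = (\<lambda>f. u f - w f)"
  \<comment> \<open>The lower bounds on p. Inserting 0 makes the set nonempty and its supremum
    nonnegative.\<close>
  define L where "L = insert 0 {\<alpha> f / (- \<delta> f) | f. f \<in> C \<and> \<delta> f < 0}"
  have ub: "l \<le> 1" if "l \<in> L" for l
  proof (cases "l = 0")
    case False
    with that obtain f where f: "f \<in> C" "\<delta> f < 0" "l = \<alpha> f / (- \<delta> f)" by (auto simp: L_def)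
    have "\<alpha> f \<le> - \<delta> f" using min[OF f(1)] f(2) by (simp add: \<alpha>_def \<delta>_def min_def)
    with f(2,3) show ?thesis by (simp add: pos_divide_le_eq del: divide_minus_right)
  qed simp
  have bdd: "bdd_above L" using ub by (auto intro!: bdd_aboveI)
  show ?thesis
  proof (intro exI conjI ballI)
    show "0 \<le> Sup L" by (rule cSup_upper[OF _ bdd]) (simp add: L_def)
    show "Sup L \<le> 1" by (rule cSup_least[OF _ ub]) (simp_all add: L_def)
    fix g assume g: "g \<in> C"
    have "\<alpha> g + Sup L * \<delta> g \<le> 0"
    proof (cases "\<delta> g" "0::real" rule: linorder_cases)
      case less
      have "\<alpha> g / (- \<delta> g) \<le> Sup L"
        by (rule cSup_upper[OF _ bdd]) (use g less in \<open>auto simp: L_def\<close>)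
      with less show ?thesis by (simp add: field_simps)
    next
      case equal
      with min[OF g] show ?thesis by (simp add: \<alpha>_def \<delta>_def)
    next
      case greater
      have "\<alpha> g \<le> 0" using min[OF g] greater by (simp add: \<alpha>_def \<delta>_def min_def)
      have "l \<le> - \<alpha> g / \<delta> g" if l: "l \<in> L" for l
      proof (cases "l = 0")
        case True
        with \<open>\<alpha> g \<le> 0\<close> greater show ?thesis by (simp add: divide_nonpos_pos)
      next
        case False
        with l obtain f where f: "f \<in> C" "\<delta> f < 0" "l = \<alpha> f / (- \<delta> f)" by (auto simp: L_def)
        \<comment> \<open>The coefficients are chosen so that \<delta> vanishes on the
          combination.\<close>
        let ?h = "\<lambda>x. \<delta> g * f x + (- \<delta> f) * g x"
        have "?h \<in> C" using closed[OF f(1) g, of "\<delta> g" "- \<delta> f"] f(2) greater by simp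
        moreover have "u ?h = w ?h"
          using u[of "\<delta> g" f "- \<delta> f" g] w[of "\<delta> g" f "- \<delta> f" g] by (simp add: \<delta>_def algebra_simps)
        ultimately have "R ?h + w ?h \<le> 0" using min[of ?h] by simp
        moreover have "\<delta> g * R f + (- \<delta> f) * R g \<le> R ?h"
          using super[OF f(1) g, of "\<delta> g" "- \<delta> f"] f(2) greater by simp
        ultimately have "\<delta> g * \<alpha> f + (- \<delta> f) * \<alpha> g \<le> 0"
          using w[of "\<delta> g" f "- \<delta> f" g] by (simp add: \<alpha>_def algebra_simps)
        moreover have "\<alpha> f = l * (- \<delta> f)" using f(2,3) by simp
        ultimately have "(- \<delta> f) * (l * \<delta> g) \<le> (- \<delta> f) * (- \<alpha> g)"
          by (simp add: algebra_simps)
        then have "l * \<delta> g \<le> - \<alpha> g"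
          by (rule mult_left_le_imp_le) (use f(2) in simp)
        with greater show ?thesis by (simp only: pos_le_divide_eq)
      qed
      then have "Sup L \<le> - \<alpha> g / \<delta> g"
        by (intro cSup_least) (auto simp: L_def)
      with greater show ?thesis by (simp add: field_simps)
    qed
    then show "R g + (Sup L * u g + (1 - Sup L) * w g) \<le> 0"
      by (simp add: \<alpha>_def \<delta>_def algebra_simps)
  qed
qed

(* A minimax theorem with the weights chosen one coordinate at a time. *)
lemma choose_weights:
  fixes C :: "('a \<Rightarrow> real) set" and \<Lambda> :: "('a \<Rightarrow> real) \<Rightarrow> real" and u w :: "'i \<Rightarrow> ('a \<Rightarrow> real) \<Rightarrow> real"
  assumes "finite I"
    and closed: "\<And>f g a b. \<lbrakk>f \<in> C; g \<in> C; 0 \<le> a; 0 \<le> b\<rbrakk> \<Longrightarrow> (\<lambda>x. a * f x + b * g x) \<in> C"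
    and \<Lambda>: "\<And>f g a b. \<lbrakk>f \<in> C; g \<in> C; 0 \<le> a; 0 \<le> b\<rbrakk> \<Longrightarrow> \<Lambda> (\<lambda>x. a * f x + b * g x) = a * \<Lambda> f + b * \<Lambda> g"
    and u: "\<And>i f g a b. u i (\<lambda>x. a * f x + b * g x) = a * u i f + b * u i g"
    and w: "\<And>i f g a b. w i (\<lambda>x. a * f x + b * g x) = a * w i f + b * w i g"
    and min: "\<And>f. f \<in> C \<Longrightarrow> (\<Sum>i\<in>I. min (u i f) (w i f)) \<le> \<Lambda> f"
  shows "\<exists>p. (\<forall>i. 0 \<le> p i \<and> p i \<le> 1) \<and> (\<forall>f\<in>C. (\<Sum>i\<in>I. p i * u i f + (1 - p i) * w i f) \<le> \<Lambda> f)"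
  using \<open>finite I\<close> \<Lambda> min
proof (induction I arbitrary: \<Lambda>)
  case empty
  then show ?case by (intro exI[of _ "\<lambda>_. 0"]) auto
next
  case (insert k I)
  let ?S = "\<lambda>f. \<Sum>i\<in>I. min (u i f) (w i f)"
  have "a * ?S f + b * ?S g \<le> ?S (\<lambda>x. a * f x + b * g x)" if "0 \<le> a" "0 \<le> b" for f g a b
  proof -
    have "a * min (u i f) (w i f) + b * min (u i g) (w i g)
        \<le> min (u i (\<lambda>x. a * f x + b * g x)) (w i (\<lambda>x. a * f x + b * g x))" for i
      unfolding u w using that by (auto intro!: add_mono mult_left_mono)
    then show ?thesis
      by (simp add: sum_distrib_left sum.distrib[symmetric] sum_mono)
  qed
  then have super: "a * (?S f - \<Lambda> f) + b * (?S g - \<Lambda> g)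
      \<le> ?S (\<lambda>x. a * f x + b * g x) - \<Lambda> (\<lambda>x. a * f x + b * g x)"
    if "f \<in> C" "g \<in> C" "0 \<le> a" "0 \<le> b" for f g a b
    using that insert.prems(1)[OF that] by (simp add: algebra_simps)
  have step: "(?S f - \<Lambda> f) + min (u k f) (w k f) \<le> 0" if "f \<in> C" for f
    using insert.prems(2)[OF that] insert.hyps by simp
  obtain q where q: "0 \<le> q" "q \<le> 1"
    "\<And>f. f \<in> C \<Longrightarrow> (?S f - \<Lambda> f) + (q * u k f + (1 - q) * w k f) \<le> 0"
    using choose_weight[of C "\<lambda>f. ?S f - \<Lambda> f" "u k" "w k", OF closed super u w step] by blast
  \<comment> \<open>With weight k fixed, its term is linear and moves to the right-hand side, which
    stays linear on C; hence the induction over arbitrary \<Lambda>.\<close>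
  let ?M = "\<lambda>f. \<Lambda> f - (q * u k f + (1 - q) * w k f)"
  have "?M (\<lambda>x. a * f x + b * g x) = a * ?M f + b * ?M g" if "f \<in> C" "g \<in> C" "0 \<le> a" "0 \<le> b" for f g a b
    by (simp add: insert.prems(1)[OF that] u w algebra_simps)
  moreover have "?S f \<le> ?M f" if "f \<in> C" for f
    using q(3)[OF that] by simp
  ultimately obtain p where p: "\<And>i. 0 \<le> p i \<and> p i \<le> 1"
    "\<And>f. f \<in> C \<Longrightarrow> (\<Sum>i\<in>I. p i * u i f + (1 - p i) * w i f) \<le> ?M f"
    using insert.IH[of ?M] by blast
  have eq: "(\<Sum>i\<in>I. (p(k := q)) i * u i f + (1 - (p(k := q)) i) * w i f)
      = (\<Sum>i\<in>I. p i * u i f + (1 - p i) * w i f)" for f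
    using insert.hyps by (intro sum.cong) auto
  show ?case
  proof (intro exI[of _ "p(k := q)"] conjI ballI allI)
    fix f assume "f \<in> C"
    from p(2)[OF this] show "(\<Sum>i\<in>insert k I. (p(k := q)) i * u i f + (1 - (p(k := q)) i) * w i f) \<le> \<Lambda> f"
      unfolding sum.insert[OF insert.hyps] eq by simp
  qed (use p(1) q in auto)
qed

section \<open>Laws dominated by the Gaussian\<close>

text \<open>Finite support turns expectations into finite sums and leaves only finitely many weights
  to choose.\<close>

definition gauss_dominated :: "'a::euclidean_space pmf \<Rightarrow> bool" where
  "gauss_dominated D \<longleftrightarrow> finite (set_pmf D) \<and>
    (\<forall>f. test_fun f \<longrightarrow> measure_pmf.expectation D f \<le> gauss_mean f)"

definition sign_pmf :: "real \<Rightarrow> real pmf" where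
  "sign_pmf p = map_pmf (\<lambda>b. if b then 1 else -1) (bernoulli_pmf p)"

lemma set_sign_pmf: "set_pmf (sign_pmf p) \<subseteq> {-1, 1}"
  by (auto simp: sign_pmf_def)

lemma expectation_sign_pmf:
  assumes "0 \<le> p" "p \<le> 1"
  shows "measure_pmf.expectation (sign_pmf p) f = p * f 1 + (1 - p) * f (-1)"
  using assms by (simp add: sign_pmf_def mult.commute)

lemma gauss_dominated_return_0: "gauss_dominated (return_pmf 0)"
  by (simp add: gauss_dominated_def Jensen_at_0)

text \<open>D is the law of the history and S its current vector, so weights are chosen per history.
  The minimax hypothesis follows by testing the old domination with the envelope of f, which bounds
  the better of the two signs and has no larger Gaussian mean than f.\<close>

lemma gauss_dominated_step:
  assumes dom: "gauss_dominated (map_pmf S D)" and fin: "finite (set_pmf D)" and v: "norm v \<le> 1"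
  shows "\<exists>p. gauss_dominated (bind_pmf D (\<lambda>x. map_pmf (\<lambda>e. S x + e *\<^sub>R v) (sign_pmf (p x))))"
proof -
  let ?u = "\<lambda>x f. pmf D x * f (S x + v)" and ?w = "\<lambda>x f. pmf D x * f (S x - v)"
  have min: "(\<Sum>x\<in>set_pmf D. min (?u x f) (?w x f)) \<le> gauss_mean f" if f: "f \<in> {f. test_fun f}" for f
  proof -
    from f have tf: "test_fun f" by simp
    then have conv: "convex_on UNIV f" and nonneg: "\<And>x. 0 \<le> f x"
      by (auto simp: test_fun_def)
    have "(\<Sum>x\<in>set_pmf D. min (?u x f) (?w x f)) \<le> (\<Sum>x\<in>set_pmf D. envelope f v (S x) * pmf D x)"
    proof (rule sum_mono)
      fix x
      have "pmf D x * min (f (S x + v)) (f (S x - v)) \<le> pmf D x * envelope f v (S x)"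
        by (rule mult_left_mono[OF min_le_envelope[OF conv nonneg]]) simp
      then show "min (?u x f) (?w x f) \<le> envelope f v (S x) * pmf D x"
        by (simp add: min_mult_distrib_left mult.commute)
    qed
    also have "\<dots> = measure_pmf.expectation (map_pmf S D) (envelope f v)"
      using fin by (simp add: integral_measure_pmf_real[of "set_pmf D"])
    also have "\<dots> \<le> gauss_mean (envelope f v)"
      using dom test_fun_envelope(1)[OF tf v] by (simp add: gauss_dominated_def)
    also have "\<dots> \<le> gauss_mean f"
      by (rule test_fun_envelope(2)[OF tf v])
    finally show ?thesis .
  qed
  have "\<exists>p. (\<forall>x. 0 \<le> p x \<and> p x \<le> 1) \<and>
    (\<forall>f\<in>{f. test_fun f}. (\<Sum>x\<in>set_pmf D. p x * ?u x f + (1 - p x) * ?w x f) \<le> gauss_mean f)"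
    by (rule choose_weights[OF fin _ _ _ _ min]) (auto simp: test_fun_lincomb algebra_simps)
  then obtain p where p: "\<And>x. 0 \<le> p x" "\<And>x. p x \<le> 1"
    "\<And>f. test_fun f \<Longrightarrow> (\<Sum>x\<in>set_pmf D. p x * ?u x f + (1 - p x) * ?w x f) \<le> gauss_mean f"
    by auto
  have fin2: "finite (set_pmf (map_pmf (\<lambda>e. S x + e *\<^sub>R v) (sign_pmf (p x))))" for x
    using finite_subset[OF set_sign_pmf] by simp
  show ?thesis
    unfolding gauss_dominated_def
  proof (intro exI[of _ p] conjI allI impI)
    show "finite (set_pmf (D \<bind> (\<lambda>x. map_pmf (\<lambda>e. S x + e *\<^sub>R v) (sign_pmf (p x)))))"
      using fin fin2 by simp
    fix f :: "'a \<Rightarrow> real" assume f: "test_fun f"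
    have "measure_pmf.expectation (D \<bind> (\<lambda>x. map_pmf (\<lambda>e. S x + e *\<^sub>R v) (sign_pmf (p x)))) f
        = (\<Sum>x\<in>set_pmf D. pmf D x *\<^sub>R measure_pmf.expectation (map_pmf (\<lambda>e. S x + e *\<^sub>R v) (sign_pmf (p x))) f)"
      by (rule pmf_expectation_bind[OF fin fin2]) simp
    also have "\<dots> = (\<Sum>x\<in>set_pmf D. p x * ?u x f + (1 - p x) * ?w x f)"
      using p(1,2) by (simp add: expectation_sign_pmf algebra_simps)
    finally show "measure_pmf.expectation (D \<bind> (\<lambda>x. map_pmf (\<lambda>e. S x + e *\<^sub>R v) (sign_pmf (p x)))) f
        \<le> gauss_mean f"
      using p(3)[OF f] by simp
  qed
qed

section \<open>From domination to subgaussianity\<close>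

text \<open>The square is linearized by exp (c^2 y^2 / 2) = E exp (c h y) with h standard normal, so
  that domination is tested with exponentials only.\<close>

lemma gauss_dominated_exp_square:
  fixes D :: "'a::euclidean_space pmf"
  assumes dom: "gauss_dominated D" and w: "norm w = 1"
  shows "(\<integral>\<^sup>+x. exp ((x \<bullet> w)\<^sup>2 / 10\<^sup>2) \<partial>measure_pmf D) \<le> 2"
proof -
  \<comment> \<open>Chosen so that c^2 / 2 = 1/100. The moment generating function is then at most
    exp (25/2 c^2 h^2) = exp (h^2 / 4), still integrable against the normal density.\<close>
  define c :: real where "c = sqrt 2 / 10"
  have c2: "c\<^sup>2 = 1 / 50" by (simp add: c_def power_divide)
  have fin: "finite (set_pmf D)" using dom by (simp add: gauss_dominated_def)
  have mgf: "measure_pmf.expectation D (\<lambda>x. exp (x \<bullet> ((c * h) *\<^sub>R w))) \<le> exp (h\<^sup>2 / 4)" for h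
  proof -
    have "measure_pmf.expectation D (\<lambda>x. exp (x \<bullet> ((c * h) *\<^sub>R w)))
        \<le> exp (25 / 2 * (((c * h) *\<^sub>R w) \<bullet> ((c * h) *\<^sub>R w)))"
      unfolding gauss_mean_exp_inner[symmetric]
      using dom test_fun_exp_inner unfolding gauss_dominated_def by blast
    also have "((c * h) *\<^sub>R w) \<bullet> ((c * h) *\<^sub>R w) = c\<^sup>2 * h\<^sup>2"
      using w by (simp add: dot_square_norm power_mult_distrib power2_eq_square)
    finally show ?thesis by (simp add: c2)
  qed
  have lin: "ennreal (exp ((x \<bullet> w)\<^sup>2 / 10\<^sup>2))
      = (\<integral>\<^sup>+h. ennreal (exp (x \<bullet> ((c * h) *\<^sub>R w)) * std_normal_density h) \<partial>lborel)" for x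
  proof -
    have "exp (x \<bullet> ((c * h) *\<^sub>R w)) * std_normal_density h
        = exp ((x \<bullet> w)\<^sup>2 / 10\<^sup>2) * normal_density (c * (x \<bullet> w)) 1 h" for h
    proof -
      have "x \<bullet> ((c * h) *\<^sub>R w) + - h\<^sup>2 / 2
          = c\<^sup>2 * (x \<bullet> w)\<^sup>2 / 2 + - (h - c * (x \<bullet> w))\<^sup>2 / 2"
        by (simp add: power2_eq_square field_simps)
      then have "x \<bullet> ((c * h) *\<^sub>R w) + - h\<^sup>2 / 2
          = (x \<bullet> w)\<^sup>2 / 10\<^sup>2 + - (h - c * (x \<bullet> w))\<^sup>2 / 2"
        by (simp add: c2)
      then have "exp (x \<bullet> ((c * h) *\<^sub>R w)) * exp (- h\<^sup>2 / 2)
          = exp ((x \<bullet> w)\<^sup>2 / 10\<^sup>2) * exp (- (h - c * (x \<bullet> w))\<^sup>2 / 2)"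
        by (simp only: exp_add[symmetric])
      then show ?thesis by (simp add: normal_density_def)
    qed
    then show ?thesis
      by (simp add: ennreal_mult nn_integral_cmult nn_integral_eq_integral)
  qed
  have "(\<integral>\<^sup>+x. exp ((x \<bullet> w)\<^sup>2 / 10\<^sup>2) \<partial>measure_pmf D)
      = (\<Sum>x\<in>set_pmf D. \<integral>\<^sup>+h. ennreal (exp (x \<bullet> ((c * h) *\<^sub>R w)) * std_normal_density h) * pmf D x \<partial>lborel)"
    unfolding lin
    by (subst nn_integral_measure_pmf_finite[OF fin]) (simp_all add: nn_integral_multc)
  also have "\<dots> = (\<integral>\<^sup>+h. (\<Sum>x\<in>set_pmf D. ennreal (exp (x \<bullet> ((c * h) *\<^sub>R w)) * std_normal_density h) * pmf D x) \<partial>lborel)"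
    by (rule nn_integral_sum[symmetric]) measurable
  also have "\<dots> \<le> (\<integral>\<^sup>+h. ennreal (sqrt 2 * normal_density 0 (sqrt 2) h) \<partial>lborel)"
  proof (rule nn_integral_mono)
    fix h :: real
    have "(\<Sum>x\<in>set_pmf D. ennreal (exp (x \<bullet> ((c * h) *\<^sub>R w)) * std_normal_density h) * pmf D x)
        = ennreal (measure_pmf.expectation D (\<lambda>x. exp (x \<bullet> ((c * h) *\<^sub>R w))) * std_normal_density h)"
      by (subst integral_measure_pmf_real[OF fin])
        (auto simp: ennreal_mult[symmetric] sum_distrib_left mult_ac)
    also have "\<dots> \<le> ennreal (exp (h\<^sup>2 / 4) * std_normal_density h)"
      by (intro ennreal_leI mult_right_mono mgf) simp
    \<comment> \<open>The exponent h^2 / 4 - h^2 / 2 = - h^2 / 4 is that of N(0, 2); the normalizing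
      constants differ by the factor sqrt 2.\<close>
    also have "exp (h\<^sup>2 / 4) * std_normal_density h = sqrt 2 * normal_density 0 (sqrt 2) h"
    proof -
      have e: "exp (h\<^sup>2 / 4) * exp (- (h - 0)\<^sup>2 / (2 * 1\<^sup>2)) = exp (- (h - 0)\<^sup>2 / (2 * (sqrt 2)\<^sup>2))"
        by (simp add: exp_add[symmetric])
      have k: "sqrt 2 * (1 / sqrt (2 * pi * (sqrt 2)\<^sup>2)) = 1 / sqrt (2 * pi * 1\<^sup>2)"
        by (simp add: real_sqrt_mult field_simps)
      show ?thesis
        unfolding normal_density_def k[symmetric] e[symmetric] by (simp only: mult_ac)
    qed
    finally show "(\<Sum>x\<in>set_pmf D. ennreal (exp (x \<bullet> ((c * h) *\<^sub>R w)) * std_normal_density h) * pmf D x)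
        \<le> ennreal (sqrt 2 * normal_density 0 (sqrt 2) h)" .
  qed
  also have "\<dots> = ennreal (sqrt 2)"
    by (simp add: ennreal_mult nn_integral_cmult nn_integral_eq_integral)
  also have "\<dots> \<le> 2"
    using ennreal_leI[of "sqrt 2" 2] sqrt2_less_2 by simp
  finally show ?thesis .
qed

section \<open>The online algorithm\<close>

definition signed_sum :: "'a::real_vector list \<Rightarrow> real list \<Rightarrow> 'a" where
  "signed_sum v xs = (\<Sum>i<length xs. (xs ! i) *\<^sub>R (v ! i))"

text \<open>One choice serves all histories at once and uses only their law and the revealed
  vectors, the newest being \<open>last v\<close>. Where no suitable p exists the choice is
  arbitrary, and \<open>sign_pmf\<close> still yields signs.\<close>

definition next_prob :: "real list pmf \<Rightarrow> 'a::euclidean_space list \<Rightarrow> real list \<Rightarrow> real" where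
  "next_prob D v = (SOME p. gauss_dominated
    (bind_pmf D (\<lambda>xs. map_pmf (\<lambda>e. signed_sum v xs + e *\<^sub>R last v) (sign_pmf (p xs)))))"

text \<open>The algorithm must know the law of its own earlier signs; defining that law first,
  without an algorithm, breaks the circularity. It can be computed from the vectors alone because
  the adversary is oblivious.\<close>

primrec sign_law :: "'a::euclidean_space list \<Rightarrow> nat \<Rightarrow> real list pmf" where
  "sign_law v 0 = return_pmf []"
| "sign_law v (Suc t) = bind_pmf (sign_law v t)
    (\<lambda>xs. map_pmf (\<lambda>x. xs @ [x]) (sign_pmf (next_prob (sign_law v t) (take (Suc t) v) xs)))"

definition balancer :: "'a::euclidean_space online_algorithm" where
  \<comment> \<open>The list v includes the current vector, so one sign fewer has been
    chosen.\<close>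
  "balancer v xs = sign_pmf (next_prob (sign_law v (length v - 1)) v xs)"

text \<open>From the revealed prefix the algorithm recovers the same law of past signs as the whole
  sequence gives.\<close>

lemma sign_law_take: "t \<le> n \<Longrightarrow> sign_law (take n v) t = sign_law v t"
  by (induction t) (simp_all add: min_absorb1)

lemma signs_balancer: "t \<le> length v \<Longrightarrow> signs balancer v t = sign_law v t"
  by (induction t) (simp_all add: balancer_def sign_law_take min_absorb2)

lemma sign_law_support: "finite (set_pmf (sign_law v t))" "xs \<in> set_pmf (sign_law v t) \<Longrightarrow> length xs = t"
proof -
  show "finite (set_pmf (sign_law v t))"
    by (induction t) (auto intro: finite_subset[OF set_sign_pmf])
  show "xs \<in> set_pmf (sign_law v t) \<Longrightarrow> length xs = t"
    by (induction t arbitrary: xs) auto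
qed

lemma signed_sum_snoc: "signed_sum v (xs @ [e]) = signed_sum v xs + e *\<^sub>R (v ! length xs)"
  by (simp add: signed_sum_def nth_append)

lemma signed_sum_take: "length xs \<le> n \<Longrightarrow> signed_sum (take n v) xs = signed_sum v xs"
  by (simp add: signed_sum_def)

lemma gauss_dominated_sign_law:
  assumes "t \<le> length v" "\<And>i. i < length v \<Longrightarrow> norm (v ! i) \<le> 1"
  shows "gauss_dominated (map_pmf (signed_sum v) (sign_law v t))"
  using assms(1)
proof (induction t)
  case 0
  then show ?case by (simp add: signed_sum_def gauss_dominated_return_0)
next
  case (Suc t)
  let ?D = "sign_law v t" and ?v = "take (Suc t) v"
  have last: "last ?v = v ! t" using Suc.prems by (simp add: take_Suc_conv_app_nth)
  \<comment> \<open>Histories under \<open>?D\<close> have length t, so their sums read only the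
    first t vectors.\<close>
  have "map_pmf (signed_sum ?v) ?D = map_pmf (signed_sum v) ?D"
    by (intro map_pmf_cong refl signed_sum_take) (auto dest: sign_law_support(2))
  then have "gauss_dominated (map_pmf (signed_sum ?v) ?D)"
    using Suc by simp
  from gauss_dominated_step[OF this sign_law_support(1), of "last ?v"]
  have "\<exists>p. gauss_dominated
      (bind_pmf ?D (\<lambda>xs. map_pmf (\<lambda>e. signed_sum ?v xs + e *\<^sub>R last ?v) (sign_pmf (p xs))))"
    using assms(2)[of t] Suc.prems last by simp
  then have "gauss_dominated (bind_pmf ?D
      (\<lambda>xs. map_pmf (\<lambda>e. signed_sum ?v xs + e *\<^sub>R last ?v) (sign_pmf (next_prob ?D ?v xs))))"
    unfolding next_prob_def by (rule someI_ex)
  also have "bind_pmf ?D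
      (\<lambda>xs. map_pmf (\<lambda>e. signed_sum ?v xs + e *\<^sub>R last ?v) (sign_pmf (next_prob ?D ?v xs)))
      = map_pmf (signed_sum v) (sign_law v (Suc t))"
    by (auto simp: map_bind_pmf pmf.map_comp o_def last signed_sum_snoc signed_sum_take
        dest!: sign_law_support(2) intro!: bind_pmf_cong)
  finally show ?case .
qed

text \<open>The theorem runs all T steps but judges a prefix. Later signs are appended, so they
  leave the law of the first t unchanged.\<close>

lemma map_take_signs:
  assumes "t \<le> T"
  shows "map_pmf (take t) (signs A v T) = signs A v t"
proof -
  have len: "xs \<in> set_pmf (signs A v n) \<Longrightarrow> length xs = n" for xs n
    by (induction n arbitrary: xs) auto
  show ?thesis
    using assms
  proof (induction T rule: dec_induct)
    case base
    show ?case by (auto simp: map_pmf_idI len)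
  next
    case (step n)
    have "map_pmf (take t) (signs A v (Suc n)) = bind_pmf (signs A v n) (\<lambda>xs. return_pmf (take t xs))"
      using step.hyps by (auto simp: map_bind_pmf pmf.map_comp o_def len map_pmf_const intro!: bind_pmf_cong)
    then show ?case using step.IH by (simp add: map_pmf_def)
  qed
qed

theorem theorem1p1:
  shows "\<exists>A :: (real ^ 'n) online_algorithm.
    chooses_signs A \<and>
    (\<forall>T. \<forall>v :: (real ^ 'n) list. length v = T \<longrightarrow> (\<forall>i<T. norm (v ! i) \<le> 1) \<longrightarrow>
      (\<forall>t\<in>{1..T}.
        subgaussian 10 (measure_pmf (signs A v T)) (\<lambda>x. \<Sum>i<t. (x ! i) *\<^sub>R (v ! i))))"
proof (intro exI conjI allI impI ballI)
  show "chooses_signs (balancer :: (real ^ 'n) online_algorithm)"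
    using set_sign_pmf by (simp add: chooses_signs_def balancer_def)
  fix T t and v :: "(real ^ 'n) list"
  assume T: "length v = T" and v: "\<forall>i<T. norm (v ! i) \<le> 1" and t: "t \<in> {1..T}"
  let ?M = "signs balancer v T" and ?X = "\<lambda>x::real list. \<Sum>i<t. (x ! i) *\<^sub>R (v ! i)"
  have law: "map_pmf (take t) ?M = sign_law v t"
    using T t map_take_signs[of t T balancer v] by (simp add: signs_balancer)
  have "?X x = ?X (take t x)" for x
    by simp
  then have "map_pmf ?X ?M = map_pmf ?X (map_pmf (take t) ?M)"
    by (simp add: pmf.map_comp o_def)
  also have "\<dots> = map_pmf (signed_sum v) (sign_law v t)"
    unfolding law by (intro map_pmf_cong) (auto simp: signed_sum_def dest: sign_law_support(2))
  finally have "gauss_dominated (map_pmf ?X ?M)"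
    using gauss_dominated_sign_law[of t v] T t v by simp
  then have "(\<integral>\<^sup>+x. exp ((?X x \<bullet> w)\<^sup>2 / 10\<^sup>2) \<partial>measure_pmf ?M) \<le> 2" if "norm w = 1" for w
    using gauss_dominated_exp_square[OF _ that] by fastforce
  then show "subgaussian 10 (measure_pmf ?M) ?X"
    \<comment> \<open>For each unit w the number 10 itself belongs to the set whose infimum is the
      norm.\<close>
    unfolding subgaussian_def psi2_inf_norm_def psi2_norm_def
    by (intro SUP_least Inf_lower) (auto intro!: exI[of _ "10::real"])
qed

end
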